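(* Let $A\subset\mathbb{R}^p$ be the disjoint union of two compact sets $A_1$ and $A_2$, both of Hausdorff dimension $d>0$, and suppose that for some $s>d$ the following hold: (1) $\operatorname{diam}(A_1)$ and $\operatorname{diam}(A_2)$ are both less than $d(A_1,A_2):=\inf\{|x-y| : x\in A_1,\ y\in A_2\}$; (2) $0<\underline g_{s,d}(A_1)<\overline g_{s,d}(A_1)<\infty$; (3) $g_{s,d}(A_2)$ exists and is positive and finite. For each $N\ge 2$ let $\omega_N^s\subset A$ be any $N$-point configuration of minimal Riesz $s$-energy on $A$, and let $\mu^{s,N}=\frac1N\sum_{x\in\omega_N^s}\delta_x$. Then the sequence of measures $\{\mu^{s,N}\}_{N=2}^\infty\subset\mathcal{M}_1(A)$ does not converge in the weak-star topology on $\mathcal{M}_1(A)$.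
   Context: For a finite configuration $\omega_N=\{x_1,\dots,x_N\}\subset\mathbb{R}^p$ of $N$ points and $s>0$, the Riesz $s$-energy is $E_s(\omega_N)=\sum_{i=1}^N\sum_{j\neq i}\frac{1}{|x_i-x_j|^s}$. For a compact infinite set $K\subset\mathbb{R}^p$ and $N\ge2$, $\mathcal{E}_s(K,N):=\inf_{\omega_N\subset K}E_s(\omega_N)$, the infimum being over $N$-point configurations in $K$; also $\mathcal{E}_s(K,0)=\mathcal{E}_s(K,1):=0$. The infimum is attained; a configuration $\omega_N^s\subset K$ of $N$ points with $E_s(\omega_N^s)=\mathcal{E}_s(K,N)$ is called a minimal $N$-point $s$-energy configuration (it need not be unique). For compact $K\subset\mathbb{R}^p$ of Hausdorff dimension $d$, define $\underline g_{s,d}(K)=\liminf_{N\to\infty}\frac{\mathcal{E}_s(K,N)}{N^{1+s/d}}$ and $\overline g_{s,d}(K)=\limsup_{N\to\infty}\frac{\mathcal{E}_s(K,N)}{N^{1+s/d}}$. If these are equal, $g_{s,d}(K)$ is said to exist and denotes the common value. $\mathcal{M}_1(A)$ is the set of Borel probability measures supported on $A$, $\delta_x$ is the unit point mass at $x$, and weak-star convergence $\mu_N\to\mu$ in $\mathcal{M}_1(A)$ means $\int f\,d\mu_N\to\int f\,d\mu$ for every continuous $f:A\to\mathbb{R}$. *)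

theory Defs
  imports "HOL-Probability.Probability"
begin

subsection \<open>Hausdorff dimension\<close>

text \<open>
  The Hausdorff measure is left unnormalised, which does not affect the dimension. It is only
  used for exponents \<open>t > 0\<close>, so the convention for \<open>0 powr 0\<close> plays no role. Covering sets are
  required to be bounded because the real-valued library function \<^const>\<open>diameter\<close> has no meaningful
  value on unbounded sets; covering sets may be empty, so finite covers are included.
\<close>

definition hausdorff_content :: "real \<Rightarrow> real \<Rightarrow> 'a::metric_space set \<Rightarrow> ennreal" where
  "hausdorff_content t \<delta> E =
     (INF U \<in> {U :: nat \<Rightarrow> 'a set. (\<forall>i. bounded (U i) \<and> diameter (U i) \<le> \<delta>) \<and> E \<subseteq> (\<Union>i. U i)}.
        \<Sum>i. ennreal (diameter (U i) powr t))"

definition hausdorff_measure :: "real \<Rightarrow> 'a::metric_space set \<Rightarrow> ennreal" where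
  "hausdorff_measure t E = (SUP \<delta> \<in> {0<..}. hausdorff_content t \<delta> E)"

definition hausdorff_dim :: "'a::metric_space set \<Rightarrow> ereal" where
  "hausdorff_dim E = (INF t \<in> {t. 0 < t \<and> hausdorff_measure t E = 0}. ereal t)"


subsection \<open>Riesz energy\<close>

text \<open>
  An \<open>N\<close>-point configuration is a set of exactly \<open>N\<close> (distinct) points. Repeated points would
  have infinite energy and hence never matter for the infimum over an infinite set.
\<close>

definition riesz_energy :: "real \<Rightarrow> 'a::metric_space set \<Rightarrow> real" where
  "riesz_energy s \<omega> = (\<Sum>x\<in>\<omega>. \<Sum>y\<in>\<omega> - {x}. 1 / dist x y powr s)"

definition configurations :: "'a set \<Rightarrow> nat \<Rightarrow> 'a set set" where
  "configurations K N = {\<omega>. \<omega> \<subseteq> K \<and> finite \<omega> \<and> card \<omega> = N}"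

text \<open>
  The real infimum below is over a nonempty set of nonnegative numbers whenever \<open>K\<close> is infinite,
  which is the only case of interest.
\<close>

definition min_energy :: "real \<Rightarrow> 'a::metric_space set \<Rightarrow> nat \<Rightarrow> real" where
  "min_energy s K N = (if N < 2 then 0 else (INF \<omega> \<in> configurations K N. riesz_energy s \<omega>))"

definition minimal_configuration :: "real \<Rightarrow> 'a::metric_space set \<Rightarrow> nat \<Rightarrow> 'a set \<Rightarrow> bool" where
  "minimal_configuration s K N \<omega> \<longleftrightarrow>
     \<omega> \<in> configurations K N \<and> riesz_energy s \<omega> = min_energy s K N"

definition g_lower :: "real \<Rightarrow> real \<Rightarrow> 'a::metric_space set \<Rightarrow> ereal" where
  "g_lower s d K = liminf (\<lambda>N. ereal (min_energy s K N / real N powr (1 + s / d)))"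

definition g_upper :: "real \<Rightarrow> real \<Rightarrow> 'a::metric_space set \<Rightarrow> ereal" where
  "g_upper s d K = limsup (\<lambda>N. ereal (min_energy s K N / real N powr (1 + s / d)))"

definition g_exists :: "real \<Rightarrow> real \<Rightarrow> 'a::metric_space set \<Rightarrow> bool" where
  "g_exists s d K \<longleftrightarrow> g_lower s d K = g_upper s d K"

text \<open>Only meaningful under \<^const>\<open>g_exists\<close>.\<close>

definition g_val :: "real \<Rightarrow> real \<Rightarrow> 'a::metric_space set \<Rightarrow> ereal" where
  "g_val s d K = g_lower s d K"


subsection \<open>Probability measures on a compact set and weak-star convergence\<close>

text \<open>
  Measures on \<open>A\<close> are represented as Borel measures on the ambient space giving full mass to \<open>A\<close>;
  for closed \<open>A\<close> this says exactly that the support is contained in \<open>A\<close>.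
\<close>

definition prob_measures_on :: "'a::topological_space set \<Rightarrow> 'a measure set" where
  "prob_measures_on A = {\<mu>. sets \<mu> = sets borel \<and> prob_space \<mu> \<and> emeasure \<mu> A = 1}"

text \<open>
  Test functions are continuous on \<open>A\<close> only; their values off \<open>A\<close> are irrelevant, whence the
  set integral over \<open>A\<close>.
\<close>

definition weak_star_conv ::
  "'a::topological_space set \<Rightarrow> (nat \<Rightarrow> 'a measure) \<Rightarrow> 'a measure \<Rightarrow> bool" where
  "weak_star_conv A M \<mu> \<longleftrightarrow>
     (\<forall>f :: 'a \<Rightarrow> real. continuous_on A f \<longrightarrow>
        (\<lambda>N. LINT x:A|M N. f x) \<longlonglongrightarrow> (LINT x:A|\<mu>. f x))"

definition empirical_measure :: "'a::topological_space set \<Rightarrow> 'a measure" where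
  "empirical_measure \<omega> =
     measure_of UNIV (sets borel)
       (\<lambda>B. ennreal (1 / real (card \<omega>)) * (\<Sum>x\<in>\<omega>. emeasure (return borel x) B))"

lemma sets_empirical_measure [simp, measurable_cong]:
  "sets (empirical_measure (\<omega> :: 'a::topological_space set)) = sets borel"
  unfolding empirical_measure_def using sets.sigma_sets_eq[of "borel :: 'a measure"] by simp

lemma emeasure_empirical_measure:
  fixes \<omega> :: "'a::topological_space set"
  assumes "B \<in> sets borel"
  shows "emeasure (empirical_measure \<omega>) B =
    ennreal (1 / real (card \<omega>)) * (\<Sum>x\<in>\<omega>. emeasure (return borel x) B)"
proof (rule emeasure_measure_of[OF empirical_measure_def])
  show "countably_additive (sets (empirical_measure \<omega>))
     (\<lambda>B. ennreal (1 / real (card \<omega>)) * (\<Sum>x\<in>\<omega>. emeasure (return borel x) B))"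
  proof (rule countably_additiveI)
    fix F :: "nat \<Rightarrow> 'a set"
    assume F: "range F \<subseteq> sets (empirical_measure \<omega>)" "disjoint_family F"
    have "(\<Sum>i. emeasure (return borel x) (F i)) = emeasure (return borel x) (\<Union>i. F i)" for x
      using F by (intro suminf_emeasure) auto
    then show "(\<Sum>i. ennreal (1 / real (card \<omega>)) * (\<Sum>x\<in>\<omega>. emeasure (return borel x) (F i))) =
      ennreal (1 / real (card \<omega>)) * (\<Sum>x\<in>\<omega>. emeasure (return borel x) (\<Union>i. F i))"
      by (simp add: suminf_sum)
  qed
qed (use assms in \<open>auto simp: positive_def\<close>)

lemma empirical_measure_in_prob_measures_on:
  fixes \<omega> :: "'a::t2_space set"
  assumes "compact A" "\<omega> \<subseteq> A" "finite \<omega>" "\<omega> \<noteq> {}"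
  shows "empirical_measure \<omega> \<in> prob_measures_on A"
proof -
  have one: "emeasure (empirical_measure \<omega>) B = 1" if "B \<in> sets borel" "\<omega> \<subseteq> B" for B
  proof -
    have "(\<Sum>x\<in>\<omega>. emeasure (return borel x) B) = (\<Sum>x\<in>\<omega>. 1)"
      using that by (intro sum.cong) (auto simp: indicator_def)
    moreover have "ennreal (1 / real (card \<omega>)) * of_nat (card \<omega>) = 1"
      using assms by (simp add: ennreal_of_nat_eq_real_of_nat flip: ennreal_mult)
    ultimately show ?thesis
      using that by (simp add: emeasure_empirical_measure)
  qed
  have "space (empirical_measure \<omega>) = UNIV"
    using sets_eq_imp_space_eq[OF sets_empirical_measure[of \<omega>]] by simp
  then show ?thesis
    using one[of A] one[of UNIV] assms
    by (auto simp: prob_measures_on_def borel_compact intro!: prob_spaceI)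
qed

end

theory Submission
  imports Defs "HOL-Real_Asymp.Real_Asymp"
begin

text \<open>
  Write \<open>q = 1 + s / d\<close>, let \<open>E\<^sub>1, E\<^sub>2\<close> be the minimal energies of \<open>A\<^sub>1, A\<^sub>2\<close>, and let \<open>k N\<close> be the
  number of points that the minimal configuration \<open>\<omega> N\<close> puts into \<open>A\<^sub>1\<close>. As \<open>A\<^sub>1\<close> is open and
  closed in \<open>A\<close>, weak-star convergence would force \<open>k N / N\<close> to converge to some \<open>\<alpha>\<close>
  (\<open>weak_star_conv_clopen\<close>). The claim is that this makes \<open>E\<^sub>1 n / n\<^sup>q\<close> converge, against the
  hypothesis that its lower and upper limits differ.

  Two points in different parts have distance at least \<open>setdist A1 A2 > 0\<close>, so the interaction
  between the parts is \<open>O(N\<^sup>2)\<close>, which is negligible against \<open>N\<^sup>q\<close> because \<open>s > d\<close>. Hence, up to this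
  error, \<open>k N\<close> minimises \<open>E\<^sub>1 n + E\<^sub>2 (N - n)\<close> over all splittings \<open>N = n + (N - n)\<close>
  (\<open>minimal_configuration_split\<close>). The rest is a statement about such sequences, developed
  in the locale \<open>optimal_splitting\<close>.

  The heuristic is that a minimal splitting equates marginal costs: the derivative of \<open>E\<^sub>1\<close> near
  \<open>\<alpha> N\<close> equals that of \<open>E\<^sub>2\<close> near \<open>(1 - \<alpha>) N\<close>, which is known since \<open>E\<^sub>2 n\<close> is asymptotic to
  \<open>c n\<^sup>q\<close>. As \<open>N\<close> varies, \<open>\<alpha> N\<close> sweeps all large numbers, so the growth rate of \<open>E\<^sub>1\<close> is known
  everywhere and \<open>E\<^sub>1\<close> cannot oscillate against \<open>n\<^sup>q\<close>. Differences of \<open>E\<^sub>1\<close> and \<open>E\<^sub>2\<close> at consecutive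
  arguments are not controlled, however, so the derivative is replaced by macroscopic steps. Put
  \<open>u N = E\<^sub>1 (k N) / N\<^sup>q\<close>, fix \<open>\<rho> < 1\<close> and let \<open>N \<sim> \<rho> M\<close>. At \<open>M\<close>, the splitting \<open>k M\<close> is no worse
  than \<open>k N\<close>; at \<open>N\<close>, the splitting \<open>k N\<close> is no worse than \<open>k M\<close>. In the limit these two comparisons
  bound \<open>u M - \<rho>\<^sup>q u N\<close> from above and below, and since \<open>\<rho>\<^sup>q < 1\<close> this contraction bounds the upper
  and lower limits of \<open>u\<close>. As \<open>\<rho> \<rightarrow> 1\<close> both bounds tend to \<open>c \<alpha> (1 - \<alpha>)\<^bsup>q-1\<^esup>\<close>, the value predicted
  by the marginal costs (\<open>u_lim\<close>; for \<open>\<alpha> = 1\<close> the upper bound alone gives \<open>u \<rightarrow> 0\<close>). Thus \<open>u\<close> converges, and monotonicity of \<open>E\<^sub>1\<close> carries this over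
  from the arguments \<open>k N\<close> to all \<open>n\<close> (\<open>tendsto_growth_if_mono\<close>), provided that \<open>\<alpha> > 0\<close>. That in
  turn holds because moving a small fraction \<open>\<beta>\<close> of all points to an almost empty \<open>A\<^sub>1\<close> costs
  \<open>O(\<beta>\<^sup>q)\<close> there but saves about \<open>c q \<beta>\<close> in \<open>A\<^sub>2\<close> (\<open>\<alpha>_pos\<close>).
\<close>

section \<open>Riesz energy\<close>

lemma riesz_energy_nonneg: "0 \<le> riesz_energy s \<sigma>"
  unfolding riesz_energy_def by (intro sum_nonneg) auto

lemma riesz_energy_mono:
  assumes "\<sigma> \<subseteq> \<tau>" "finite \<tau>"
  shows "riesz_energy s \<sigma> \<le> riesz_energy s \<tau>"
proof -
  have "riesz_energy s \<sigma> \<le> (\<Sum>x\<in>\<sigma>. \<Sum>y\<in>\<tau> - {x}. 1 / dist x y powr s)"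
    unfolding riesz_energy_def using assms by (intro sum_mono sum_mono2) auto
  also have "\<dots> \<le> riesz_energy s \<tau>"
    unfolding riesz_energy_def using assms by (intro sum_mono2 sum_nonneg) auto
  finally show ?thesis .
qed

lemma riesz_energy_card_less_2:
  assumes "finite \<sigma>" "card \<sigma> < 2"
  shows "riesz_energy s \<sigma> = 0"
proof -
  have "x = y" if "x \<in> \<sigma>" "y \<in> \<sigma>" for x y
    using assms that card_le_Suc0_iff_eq[of \<sigma>] by auto
  then show ?thesis
    unfolding riesz_energy_def by (intro sum.neutral ballI) blast
qed

lemma riesz_energy_Un:
  assumes "finite \<sigma>" "finite \<tau>" "\<sigma> \<inter> \<tau> = {}"
  shows "riesz_energy s (\<sigma> \<union> \<tau>) =
    riesz_energy s \<sigma> + riesz_energy s \<tau> + 2 * (\<Sum>x\<in>\<sigma>. \<Sum>y\<in>\<tau>. 1 / dist x y powr s)"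
proof -
  have *: "(\<Sum>x\<in>\<sigma>. \<Sum>y\<in>(\<sigma> \<union> \<tau>) - {x}. 1 / dist x y powr s) =
      riesz_energy s \<sigma> + (\<Sum>x\<in>\<sigma>. \<Sum>y\<in>\<tau>. 1 / dist x y powr s)"
    if "finite \<sigma>" "finite \<tau>" "\<sigma> \<inter> \<tau> = {}" for \<sigma> \<tau> :: "'a set"
  proof -
    have "(\<Sum>y\<in>(\<sigma> \<union> \<tau>) - {x}. 1 / dist x y powr s) =
        (\<Sum>y\<in>\<sigma> - {x}. 1 / dist x y powr s) + (\<Sum>y\<in>\<tau>. 1 / dist x y powr s)" if "x \<in> \<sigma>" for x
    proof -
      have "(\<sigma> \<union> \<tau>) - {x} = (\<sigma> - {x}) \<union> \<tau>"
        using that \<open>\<sigma> \<inter> \<tau> = {}\<close> by auto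
      then show ?thesis
        using \<open>finite \<sigma>\<close> \<open>finite \<tau>\<close> \<open>\<sigma> \<inter> \<tau> = {}\<close> by (simp add: sum.union_disjoint Diff_Int_distrib2)
    qed
    then show ?thesis
      by (simp add: riesz_energy_def sum.distrib)
  qed
  have "riesz_energy s (\<sigma> \<union> \<tau>) = (\<Sum>x\<in>\<sigma>. \<Sum>y\<in>(\<sigma> \<union> \<tau>) - {x}. 1 / dist x y powr s)
      + (\<Sum>x\<in>\<tau>. \<Sum>y\<in>(\<tau> \<union> \<sigma>) - {x}. 1 / dist x y powr s)"
    using assms unfolding riesz_energy_def by (simp add: sum.union_disjoint Un_commute)
  also have "\<dots> = riesz_energy s \<sigma> + (\<Sum>x\<in>\<sigma>. \<Sum>y\<in>\<tau>. 1 / dist x y powr s)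
      + (riesz_energy s \<tau> + (\<Sum>x\<in>\<tau>. \<Sum>y\<in>\<sigma>. 1 / dist x y powr s))"
    using assms by (subst (1 2) *) auto
  also have "(\<Sum>x\<in>\<tau>. \<Sum>y\<in>\<sigma>. 1 / dist x y powr s) = (\<Sum>x\<in>\<sigma>. \<Sum>y\<in>\<tau>. 1 / dist x y powr s)"
    by (subst sum.swap) (simp add: dist_commute)
  finally show ?thesis by simp
qed

lemma min_energy_le:
  assumes "\<sigma> \<in> configurations K n"
  shows "min_energy s K n \<le> riesz_energy s \<sigma>"
proof (cases "n < 2")
  case True
  then show ?thesis by (simp add: min_energy_def riesz_energy_nonneg)
next
  case False
  then show ?thesis
    using assms riesz_energy_nonneg
    by (auto simp: min_energy_def intro!: cINF_lower bdd_belowI2[where m = 0])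
qed

text \<open>
  In comparisons of minimal energies, near-minimisers stand in for minimisers: the error \<open>e\<close> is
  arbitrary. For \<open>n < 2\<close> the minimal energy is \<open>0\<close> by definition and every configuration attains it.
\<close>

lemma near_minimal_configuration:
  assumes "infinite K" "e > 0"
  shows "\<exists>\<sigma>\<in>configurations K n. riesz_energy s \<sigma> < min_energy s K n + e"
proof -
  obtain \<tau> where \<tau>: "\<tau> \<in> configurations K n"
    using infinite_arbitrarily_large[OF assms(1), of n] by (auto simp: configurations_def)
  show ?thesis
  proof (cases "n < 2")
    case True
    then show ?thesis
      using \<tau> assms(2) riesz_energy_card_less_2[of \<tau> s]
      by (intro bexI[of _ \<tau>]) (auto simp: configurations_def min_energy_def)
  next
    case False
    show ?thesis
      using False \<tau> assms(2) riesz_energy_nonneg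
      by (subst cINF_less_iff[symmetric]) (auto simp: min_energy_def intro!: bdd_belowI2[where m = 0])
  qed
qed

lemma min_energy_nonneg:
  assumes "infinite K"
  shows "0 \<le> min_energy s K n"
proof (rule field_le_epsilon)
  fix e :: real assume "e > 0"
  then obtain \<sigma> where "\<sigma> \<in> configurations K n" "riesz_energy s \<sigma> < min_energy s K n + e"
    using near_minimal_configuration[OF assms, of e n s] by auto
  then show "0 \<le> min_energy s K n + e"
    using riesz_energy_nonneg[of s \<sigma>] by linarith
qed

text \<open>Dropping points from a configuration removes nonnegative terms from its energy.\<close>

lemma mono_min_energy:
  assumes "infinite K"
  shows "mono (min_energy s K)"
proof (rule monoI, rule field_le_epsilon)
  fix m n :: nat and e :: real assume "m \<le> n" "e > 0"
  then obtain \<sigma> where \<sigma>: "\<sigma> \<in> configurations K n" "riesz_energy s \<sigma> < min_energy s K n + e"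
    using near_minimal_configuration[OF assms, of e n s] by auto
  then obtain \<tau> where \<tau>: "\<tau> \<subseteq> \<sigma>" "card \<tau> = m"
    using \<open>m \<le> n\<close> obtain_subset_with_card_n[of m \<sigma>] by (auto simp: configurations_def)
  then have "\<tau> \<in> configurations K m" "finite \<sigma>"
    using \<sigma> by (auto simp: configurations_def finite_subset)
  then show "min_energy s K m \<le> min_energy s K n + e"
    using min_energy_le[of \<tau> K m s] riesz_energy_mono[OF \<tau>(1), of s] \<sigma> by linarith
qed

text \<open>
  A finite \<open>K\<close> has no configurations with many points, so its minimal energy is eventually the
  constant \<open>Inf {}\<close>, and the normalised energy tends to \<open>0\<close>.
\<close>

lemma infinite_if_g_lower_pos:
  assumes "0 < g_lower s d K" "0 < s" "0 < d"
  shows "infinite K"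
proof
  assume "finite K"
  define q where "q = 1 + s / d"
  have "q > 0" using assms by (simp add: q_def add_pos_pos)
  define z :: real where "z = Inf {}"
  have "min_energy s K N = z" if "N > card K + 2" for N
  proof -
    have "configurations K N = {}"
    proof -
      have "card \<sigma> \<noteq> N" if "\<sigma> \<subseteq> K" for \<sigma>
        using card_mono[OF \<open>finite K\<close> that] \<open>card K + 2 < N\<close> by simp
      then show ?thesis by (auto simp: configurations_def)
    qed
    then show ?thesis using that by (simp add: min_energy_def z_def)
  qed
  then have "\<forall>\<^sub>F N in sequentially. z / real N powr q = min_energy s K N / real N powr q"
    by (intro eventually_mono[OF eventually_gt_at_top[of "card K + 2"]]) auto
  moreover have "(\<lambda>N. z / real N powr q) \<longlonglongrightarrow> 0"
    using \<open>q > 0\<close> by real_asymp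
  ultimately have "(\<lambda>N. min_energy s K N / real N powr q) \<longlonglongrightarrow> 0"
    by (rule Lim_transform_eventually[rotated])
  then have "(\<lambda>N. ereal (min_energy s K N / real N powr q)) \<longlonglongrightarrow> ereal 0"
    by simp
  then have "g_lower s d K = ereal 0"
    unfolding g_lower_def q_def by (intro lim_imp_Liminf) auto
  then show False using assms by simp
qed

text \<open>
  The two parts of \<open>\<omega>\<close> have at least the minimal energies for their sizes. Conversely, near-minimal
  configurations of \<open>n\<close> points in \<open>A1\<close> and \<open>N - n\<close> points in \<open>A2\<close> together compete with \<open>\<omega>\<close>, and the
  last summand bounds their interaction.
\<close>

lemma minimal_configuration_split:
  fixes A1 A2 :: "'a::metric_space set"
  assumes inf: "infinite A1" "infinite A2" and D: "0 < setdist A1 A2" and "0 < s"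
    and min: "minimal_configuration s (A1 \<union> A2) N \<omega>" and "n \<le> N"
  shows "card (\<omega> \<inter> A1) \<le> N"
    and "min_energy s A1 (card (\<omega> \<inter> A1)) + min_energy s A2 (N - card (\<omega> \<inter> A1))
      \<le> min_energy s A1 n + min_energy s A2 (N - n) + 2 / setdist A1 A2 powr s * real N ^ 2"
proof -
  let ?D = "setdist A1 A2"
  have dist_ge: "?D \<le> dist x y" if "x \<in> A1" "y \<in> A2" for x y
    using that by (rule setdist_le_dist)
  then have disj: "A1 \<inter> A2 = {}" using D by force
  have \<omega>: "\<omega> \<subseteq> A1 \<union> A2" "finite \<omega>" "card \<omega> = N"
    and E: "riesz_energy s \<omega> = min_energy s (A1 \<union> A2) N"
    using min by (auto simp: minimal_configuration_def configurations_def)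
  have \<omega>_Un: "(\<omega> \<inter> A1) \<union> (\<omega> \<inter> A2) = \<omega>" using \<omega> by auto
  have card: "card (\<omega> \<inter> A1) + card (\<omega> \<inter> A2) = N"
    using card_Un_disjoint[of "\<omega> \<inter> A1" "\<omega> \<inter> A2"] \<omega> \<omega>_Un disj
    by (simp add: disjoint_iff)
  then show "card (\<omega> \<inter> A1) \<le> N" by simp
  have c2: "card (\<omega> \<inter> A2) = N - card (\<omega> \<inter> A1)" using card by simp
  have "min_energy s A1 (card (\<omega> \<inter> A1)) + min_energy s A2 (N - card (\<omega> \<inter> A1))
      \<le> riesz_energy s (\<omega> \<inter> A1) + riesz_energy s (\<omega> \<inter> A2)"
    using \<omega> c2 by (intro add_mono min_energy_le) (auto simp: configurations_def)
  also have "\<dots> \<le> riesz_energy s ((\<omega> \<inter> A1) \<union> (\<omega> \<inter> A2))"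
    using \<omega> disj by (subst riesz_energy_Un) (auto intro!: sum_nonneg)
  also have "\<dots> = min_energy s (A1 \<union> A2) N" using E \<omega>_Un by simp
  also have "\<dots> \<le> min_energy s A1 n + min_energy s A2 (N - n) + 2 / ?D powr s * real N ^ 2"
  proof (rule field_le_epsilon)
    fix e :: real assume "e > 0"
    obtain \<sigma> where \<sigma>: "\<sigma> \<in> configurations A1 n" "riesz_energy s \<sigma> < min_energy s A1 n + e / 2"
      using near_minimal_configuration[OF inf(1), of "e / 2"] \<open>e > 0\<close> by auto
    obtain \<tau> where \<tau>: "\<tau> \<in> configurations A2 (N - n)"
        "riesz_energy s \<tau> < min_energy s A2 (N - n) + e / 2"
      using near_minimal_configuration[OF inf(2), of "e / 2"] \<open>e > 0\<close> by auto
    have fin: "finite \<sigma>" "finite \<tau>" "\<sigma> \<inter> \<tau> = {}"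
      using \<sigma> \<tau> disj by (auto simp: configurations_def)
    have "\<sigma> \<union> \<tau> \<in> configurations (A1 \<union> A2) N"
      using \<sigma> \<tau> fin \<open>n \<le> N\<close> by (auto simp: configurations_def card_Un_disjoint)
    then have "min_energy s (A1 \<union> A2) N \<le> riesz_energy s (\<sigma> \<union> \<tau>)"
      by (rule min_energy_le)
    also have "\<dots> = riesz_energy s \<sigma> + riesz_energy s \<tau>
        + 2 * (\<Sum>x\<in>\<sigma>. \<Sum>y\<in>\<tau>. 1 / dist x y powr s)"
      using fin by (rule riesz_energy_Un)
    also have "(\<Sum>x\<in>\<sigma>. \<Sum>y\<in>\<tau>. 1 / dist x y powr s) \<le> (\<Sum>x\<in>\<sigma>. \<Sum>y\<in>\<tau>. 1 / ?D powr s)"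
    proof (intro sum_mono)
      fix x y assume "x \<in> \<sigma>" "y \<in> \<tau>"
      then have "?D \<le> dist x y" using \<sigma> \<tau> dist_ge by (auto simp: configurations_def)
      then show "1 / dist x y powr s \<le> 1 / ?D powr s"
        using D \<open>0 < s\<close> by (intro divide_left_mono powr_mono2 mult_pos_pos) auto
    qed
    also have "\<dots> = real n * real (N - n) / ?D powr s"
      using \<sigma> \<tau> by (simp add: configurations_def)
    also have "\<dots> \<le> real N ^ 2 / ?D powr s"
      using \<open>n \<le> N\<close> unfolding power2_eq_square by (intro divide_right_mono mult_mono) auto
    finally show "min_energy s (A1 \<union> A2) N
        \<le> min_energy s A1 n + min_energy s A2 (N - n) + 2 / ?D powr s * real N ^ 2 + e"
      using \<sigma>(2) \<tau>(2) by simp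
  qed
  finally show "min_energy s A1 (card (\<omega> \<inter> A1)) + min_energy s A2 (N - card (\<omega> \<inter> A1))
      \<le> min_energy s A1 n + min_energy s A2 (N - n) + 2 / ?D powr s * real N ^ 2" .
qed

section \<open>Asymptotics\<close>

text \<open>
  Taking upper limits in the recursive inequality gives \<open>limsup u \<le> \<kappa> * limsup u + w0\<close>, which can
  be solved for the upper limit because it is finite.
\<close>

lemma eventually_less_if_contracting:
  fixes u w :: "nat \<Rightarrow> real"
  assumes "Bseq u" "0 \<le> \<kappa>" "\<kappa> < 1" "filterlim N at_top sequentially" "w \<longlonglongrightarrow> w0"
    and le: "\<forall>\<^sub>F M in sequentially. u M \<le> \<kappa> * u (N M) + w M"
    and x: "w0 / (1 - \<kappa>) < x"
  shows "\<forall>\<^sub>F M in sequentially. u M < x"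
proof -
  obtain C where C: "\<And>n. \<bar>u n\<bar> \<le> C"
    using \<open>Bseq u\<close> by (auto simp: Bseq_def)
  \<comment> \<open>The infimum \<open>U\<close> of the eventual upper bounds is the upper limit of \<open>u\<close>, as a real number.\<close>
  define S where "S = {y. \<forall>\<^sub>F M in sequentially. u M \<le> y}"
  have "C \<in> S" using C by (auto simp: S_def abs_le_iff)
  have "-C \<le> y" if "y \<in> S" for y
  proof -
    from that obtain n where "u n \<le> y" by (auto simp: S_def eventually_sequentially)
    then show ?thesis using C[of n] by linarith
  qed
  then have bdd: "bdd_below S" by (auto simp: bdd_below_def)
  define U where "U = Inf S"
  have U: "\<forall>\<^sub>F M in sequentially. u M \<le> y" if "U < y" for y
  proof -
    obtain z where "z \<in> S" "z < y"
      using \<open>U < y\<close> cInf_less_iff[OF _ bdd] \<open>C \<in> S\<close> unfolding U_def by auto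
    from \<open>z \<in> S\<close> have "\<forall>\<^sub>F M in sequentially. u M \<le> z" by (simp add: S_def)
    then show ?thesis by eventually_elim (use \<open>z < y\<close> in simp)
  qed
  have "U \<le> \<kappa> * U + w0"
  proof (rule field_le_epsilon)
    fix e :: real assume "e > 0"
    have "\<forall>\<^sub>F M in sequentially. u (N M) \<le> U + e / 2"
      using \<open>e > 0\<close> by (intro eventually_compose_filterlim[OF U assms(4)]) simp
    moreover have "\<forall>\<^sub>F M in sequentially. w M < w0 + e / 2"
      using assms(5) \<open>e > 0\<close> by (intro order_tendstoD) auto
    ultimately have "\<forall>\<^sub>F M in sequentially. u M \<le> \<kappa> * U + w0 + e"
      using le
    proof eventually_elim
      case (elim M)
      have "\<kappa> * u (N M) \<le> \<kappa> * (U + e / 2)" using elim assms(2) by (intro mult_left_mono) auto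
      also have "\<dots> \<le> \<kappa> * U + e / 2" using assms(3) \<open>e > 0\<close> by (simp add: algebra_simps)
      finally show ?case using elim by linarith
    qed
    then show "U \<le> \<kappa> * U + w0 + e"
      unfolding U_def using bdd by (intro cInf_lower) (auto simp: S_def)
  qed
  then have "U \<le> w0 / (1 - \<kappa>)"
    using assms(3) by (simp add: field_simps)
  then obtain y where "U < y" "y < x" using x dense[of U x] by auto
  from U[OF \<open>U < y\<close>] show ?thesis by eventually_elim (use \<open>y < x\<close> in simp)
qed

text \<open>
  For \<open>\<gamma> > 0\<close> the arguments \<open>m M\<close> tend to infinity and the growth of \<open>f\<close> applies. For \<open>\<gamma> = 0\<close> they may
  stay bounded; then it matters that \<open>f n / n powr q\<close> is bounded, and that \<open>f 0 = 0\<close> makes this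
  bound usable when \<open>m M = 0\<close>.
\<close>

lemma tendsto_powr_growth_along:
  fixes f :: "nat \<Rightarrow> real" and m :: "nat \<Rightarrow> nat"
  assumes f: "(\<lambda>n. f n / real n powr q) \<longlonglongrightarrow> c" and "f 0 = 0" "q > 0"
    and m: "(\<lambda>M. real (m M) / real M) \<longlonglongrightarrow> \<gamma>"
  shows "(\<lambda>M. f (m M) / real M powr q) \<longlonglongrightarrow> c * \<gamma> powr q"
proof -
  define h where "h n = f n / real n powr q" for n
  have "\<gamma> \<ge> 0" using m by (rule LIMSEQ_le_const) auto
  have eq: "\<forall>\<^sub>F M in sequentially. h (m M) * (real (m M) / real M) powr q = f (m M) / real M powr q"
    using eventually_gt_at_top[of 0]
  proof eventually_elim
    case (elim M)
    then show ?case
      using \<open>f 0 = 0\<close> by (cases "m M = 0") (auto simp: h_def powr_divide)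
  qed
  have lim: "(\<lambda>M. (real (m M) / real M) powr q) \<longlonglongrightarrow> \<gamma> powr q"
    using m \<open>q > 0\<close> by (intro tendsto_powr2) auto
  have "(\<lambda>M. h (m M) * (real (m M) / real M) powr q) \<longlonglongrightarrow> c * \<gamma> powr q"
  proof (cases "\<gamma> = 0")
    case True
    have "Bseq h"
      using f unfolding h_def by (intro convergent_imp_Bseq convergentI)
    then obtain K where "\<And>n. norm (h n) \<le> K" by (auto simp: Bseq_def)
    then have "(\<lambda>M. h (m M) * (real (m M) / real M) powr q) \<longlonglongrightarrow> 0"
      using lim True \<open>q > 0\<close> by (intro lim_null_mult_left_bounded[where B = K]) auto
    then show ?thesis using True \<open>q > 0\<close> by simp
  next
    case False
    then have "filterlim (\<lambda>M. real (m M) / real M * real M) at_top sequentially"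
      using \<open>\<gamma> \<ge> 0\<close> m by (intro filterlim_tendsto_pos_mult_at_top[OF m] filterlim_real_sequentially) auto
    moreover have "\<forall>\<^sub>F M in sequentially. real (m M) / real M * real M = real (m M)"
      using eventually_gt_at_top[of 0] by eventually_elim auto
    ultimately have "filterlim (\<lambda>M. real (m M)) at_top sequentially"
      by (simp cong: filterlim_cong)
    then have "filterlim m at_top sequentially"
      using filterlim_sequentially_iff_filterlim_real by blast
    then have "(\<lambda>M. h (m M)) \<longlonglongrightarrow> c"
      using f unfolding h_def by (rule filterlim_compose[rotated])
    then show ?thesis using lim by (rule tendsto_mult)
  qed
  then show ?thesis using eq by (rule Lim_transform_eventually)
qed

text \<open>
  The values \<open>k N\<close> grow like \<open>\<alpha> N\<close> but may skip numbers. For \<open>N\<close> close to \<open>\<rho> n\<close>, the ratio \<open>k N / n\<close>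
  is close to \<open>\<alpha> \<rho>\<close>, so \<open>k N\<close> lies below or above \<open>n\<close> according to whether \<open>\<rho> < 1 / \<alpha>\<close> or
  \<open>\<rho> > 1 / \<alpha>\<close>. Monotonicity squeezes \<open>f n\<close> between such values, and letting \<open>\<rho> \<rightarrow> 1 / \<alpha>\<close> closes the
  gap.
\<close>

lemma tendsto_growth_if_mono:
  fixes f :: "nat \<Rightarrow> real" and k :: "nat \<Rightarrow> nat"
  assumes "mono f" "0 < \<alpha>"
    and k: "(\<lambda>N. real (k N) / real N) \<longlonglongrightarrow> \<alpha>"
    and lim: "(\<lambda>N. f (k N) / real N powr q) \<longlonglongrightarrow> l"
  shows "(\<lambda>n. f n / real n powr q) \<longlonglongrightarrow> l / \<alpha> powr q"
proof -
  define N where "N \<rho> n = nat \<lfloor>\<rho> * real n\<rfloor>" for \<rho> :: real and n :: nat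
  have top: "filterlim (N \<rho>) at_top sequentially" if "\<rho> > 0" for \<rho>
    unfolding N_def using that by real_asymp
  have ratio: "(\<lambda>n. real (N \<rho> n) / real n) \<longlonglongrightarrow> \<rho>" if "\<rho> > 0" for \<rho>
    unfolding N_def using that by real_asymp
  have kN: "(\<lambda>n. real (k (N \<rho> n)) / real n) \<longlonglongrightarrow> \<alpha> * \<rho>" if "\<rho> > 0" for \<rho>
  proof -
    have "(\<lambda>n. real (k (N \<rho> n)) / real (N \<rho> n) * (real (N \<rho> n) / real n)) \<longlonglongrightarrow> \<alpha> * \<rho>"
      by (intro tendsto_mult ratio that filterlim_compose[OF k top])
    moreover have "\<forall>\<^sub>F n in sequentially.
        real (k (N \<rho> n)) / real (N \<rho> n) * (real (N \<rho> n) / real n) = real (k (N \<rho> n)) / real n"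
      using top[OF that, unfolded filterlim_at_top, rule_format, of 1] by eventually_elim auto
    ultimately show ?thesis by (rule Lim_transform_eventually)
  qed
  have fN: "(\<lambda>n. f (k (N \<rho> n)) / real n powr q) \<longlonglongrightarrow> l * \<rho> powr q" if "\<rho> > 0" for \<rho>
  proof -
    have "(\<lambda>n. f (k (N \<rho> n)) / real (N \<rho> n) powr q * (real (N \<rho> n) / real n) powr q) \<longlonglongrightarrow> l * \<rho> powr q"
      using that by (intro tendsto_mult tendsto_powr ratio filterlim_compose[OF lim top]) auto
    moreover have "\<forall>\<^sub>F n in sequentially.
        f (k (N \<rho> n)) / real (N \<rho> n) powr q * (real (N \<rho> n) / real n) powr q = f (k (N \<rho> n)) / real n powr q"
      using top[OF that, unfolded filterlim_at_top, rule_format, of 1] by eventually_elim (auto simp: powr_divide)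
    ultimately show ?thesis by (rule Lim_transform_eventually)
  qed
  have cont: "((\<lambda>\<rho>. l * \<rho> powr q) \<longlongrightarrow> l * (1 / \<alpha>) powr q) (at (1 / \<alpha>) within T)" for T
    using \<open>0 < \<alpha>\<close> by (intro tendsto_intros) auto
  have limit: "l * (1 / \<alpha>) powr q = l / \<alpha> powr q"
    using \<open>0 < \<alpha>\<close> by (simp add: powr_divide)
  show ?thesis
  proof (rule order_tendstoI)
    fix x assume "x < l / \<alpha> powr q"
    then have "\<forall>\<^sub>F \<rho> in at_left (1 / \<alpha>). x < l * \<rho> powr q"
      using cont limit by (intro order_tendstoD) auto
    moreover have "\<forall>\<^sub>F \<rho> in at_left (1 / \<alpha>). \<rho> \<in> {0<..<1 / \<alpha>}"
      using \<open>0 < \<alpha>\<close> by (intro eventually_at_left_real) auto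
    ultimately have "\<forall>\<^sub>F \<rho> in at_left (1 / \<alpha>). x < l * \<rho> powr q \<and> \<rho> \<in> {0<..<1 / \<alpha>}"
      by eventually_elim auto
    then obtain \<rho> where \<rho>: "x < l * \<rho> powr q" "0 < \<rho>" "\<rho> < 1 / \<alpha>"
      using eventually_happens'[OF trivial_limit_at_left_real] by auto
    have "\<forall>\<^sub>F n in sequentially. real (k (N \<rho> n)) / real n < 1"
      using kN[OF \<rho>(2)] \<rho> \<open>0 < \<alpha>\<close> by (intro order_tendstoD) (auto simp: field_simps)
    moreover have "\<forall>\<^sub>F n in sequentially. x < f (k (N \<rho> n)) / real n powr q"
      using fN[OF \<rho>(2)] \<rho> by (intro order_tendstoD) auto
    ultimately show "\<forall>\<^sub>F n in sequentially. x < f n / real n powr q"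
      using eventually_gt_at_top[of 0]
    proof eventually_elim
      case (elim n)
      then have "f (k (N \<rho> n)) \<le> f n" by (intro monoD[OF \<open>mono f\<close>]) (simp add: divide_less_eq)
      then have "f (k (N \<rho> n)) / real n powr q \<le> f n / real n powr q" by (intro divide_right_mono) auto
      then show ?case using elim by linarith
    qed
  next
    fix x assume "l / \<alpha> powr q < x"
    then have "\<forall>\<^sub>F \<rho> in at_right (1 / \<alpha>). l * \<rho> powr q < x"
      using cont limit by (intro order_tendstoD) auto
    moreover have "\<forall>\<^sub>F \<rho> in at_right (1 / \<alpha>). 1 / \<alpha> < \<rho>"
      by (rule eventually_at_right_less)
    ultimately have "\<forall>\<^sub>F \<rho> in at_right (1 / \<alpha>). l * \<rho> powr q < x \<and> 1 / \<alpha> < \<rho>"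
      by eventually_elim auto
    then obtain \<rho> where \<rho>: "l * \<rho> powr q < x" "1 / \<alpha> < \<rho>"
      using eventually_happens'[OF trivial_limit_at_right_real] by auto
    moreover have "0 < 1 / \<alpha>" using \<open>0 < \<alpha>\<close> by simp
    ultimately have "\<rho> > 0" by linarith
    have "\<forall>\<^sub>F n in sequentially. 1 < real (k (N \<rho> n)) / real n"
      using kN[OF \<open>\<rho> > 0\<close>] \<rho> \<open>0 < \<alpha>\<close> by (intro order_tendstoD) (auto simp: field_simps)
    moreover have "\<forall>\<^sub>F n in sequentially. f (k (N \<rho> n)) / real n powr q < x"
      using fN[OF \<open>\<rho> > 0\<close>] \<rho> by (intro order_tendstoD) auto
    ultimately show "\<forall>\<^sub>F n in sequentially. f n / real n powr q < x"
      using eventually_gt_at_top[of 0]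
    proof eventually_elim
      case (elim n)
      then have "f n \<le> f (k (N \<rho> n))" by (intro monoD[OF \<open>mono f\<close>]) (simp add: less_divide_eq)
      then have "f n / real n powr q \<le> f (k (N \<rho> n)) / real n powr q" by (intro divide_right_mono) auto
      then show ?case using elim by linarith
    qed
  qed
qed


section \<open>Optimal splittings\<close>

text \<open>
  The number \<open>k N\<close> minimises \<open>E1 n + E2 (N - n)\<close> up to an error of lower order than \<open>N powr q\<close>. Of
  \<open>E2\<close> the asymptotic growth is known, of \<open>E1\<close> an upper bound of the same order.
\<close>

locale optimal_splitting =
  fixes E1 E2 :: "nat \<Rightarrow> real" and k :: "nat \<Rightarrow> nat" and q B C c \<alpha> :: real
  assumes mono_E1: "mono E1" and E1_nonneg: "0 \<le> E1 n" and E2_0: "E2 0 = 0" and q_gt_2: "2 < q"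
    and E1_le: "\<forall>\<^sub>F n in sequentially. E1 n \<le> C * real n powr q"
    and E2_growth: "(\<lambda>n. E2 n / real n powr q) \<longlonglongrightarrow> c" and c_pos: "0 < c"
    and k_le: "2 \<le> N \<Longrightarrow> k N \<le> N"
    and k_lim: "(\<lambda>N. real (k N) / real N) \<longlonglongrightarrow> \<alpha>"
    and optimal: "2 \<le> N \<Longrightarrow> n \<le> N \<Longrightarrow>
      E1 (k N) + E2 (N - k N) \<le> E1 n + E2 (N - n) + B * real N ^ 2"
begin

lemma \<alpha>_nonneg: "0 \<le> \<alpha>"
  using k_lim by (rule LIMSEQ_le_const) auto

lemma \<alpha>_le_1: "\<alpha> \<le> 1"
proof (rule LIMSEQ_le_const2[OF k_lim])
  show "\<exists>N. \<forall>n\<ge>N. real (k n) / real n \<le> 1"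
    using k_le by (intro exI[of _ 2]) (auto simp: divide_le_eq)
qed

lemma E2_lim_along:
  assumes "(\<lambda>M. real (m M) / real M) \<longlonglongrightarrow> \<gamma>"
  shows "(\<lambda>M. E2 (m M) / real M powr q) \<longlonglongrightarrow> c * \<gamma> powr q"
  using E2_growth E2_0 _ assms by (rule tendsto_powr_growth_along) (use q_gt_2 in simp)

lemma E2_lim_along_diff:
  assumes "(\<lambda>M. real (m M) / real M) \<longlonglongrightarrow> \<gamma>" "(\<lambda>M. real (m' M) / real M) \<longlonglongrightarrow> \<gamma>'"
    and "\<forall>\<^sub>F M in sequentially. m' M \<le> m M"
  shows "(\<lambda>M. E2 (m M - m' M) / real M powr q) \<longlonglongrightarrow> c * (\<gamma> - \<gamma>') powr q"
proof (rule E2_lim_along)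
  have "(\<lambda>M. real (m M) / real M - real (m' M) / real M) \<longlonglongrightarrow> \<gamma> - \<gamma>'"
    using assms by (intro tendsto_diff)
  moreover have "\<forall>\<^sub>F M in sequentially.
      real (m M) / real M - real (m' M) / real M = real (m M - m' M) / real M"
    using assms(3) by eventually_elim (simp add: of_nat_diff diff_divide_distrib)
  ultimately show "(\<lambda>M. real (m M - m' M) / real M) \<longlonglongrightarrow> \<gamma> - \<gamma>'"
    by (rule Lim_transform_eventually)
qed

lemma id_lim: "(\<lambda>M. real M / real M) \<longlonglongrightarrow> 1"
  by real_asymp

text \<open>
  If \<open>\<alpha> = 0\<close>, nearly all points lie in the second part, at cost \<open>c\<close> after normalisation. Moving a
  fraction \<open>\<beta>\<close> of them would give \<open>c \<le> C * \<beta> powr q + c * (1 - \<beta>) powr q\<close>, which fails for small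
  \<open>\<beta>\<close>: the first summand is superlinear in \<open>\<beta>\<close>, while the second falls short of \<open>c\<close> by about
  \<open>c * q * \<beta>\<close>.
\<close>

lemma \<alpha>_pos: "0 < \<alpha>"
proof (rule ccontr)
  assume "\<not> 0 < \<alpha>"
  then have "\<alpha> = 0" using \<alpha>_nonneg by simp
  have ineq: "c \<le> C * \<beta> powr q + c * (1 - \<beta>) powr q" if "0 < \<beta>" "\<beta> < 1" for \<beta>
  proof -
    define n where "n M = nat \<lfloor>\<beta> * real M\<rfloor>" for M
    have n_lim: "(\<lambda>M. real (n M) / real M) \<longlonglongrightarrow> \<beta>"
      unfolding n_def using that by real_asymp
    have n_le: "n M \<le> M" for M
      unfolding n_def using mult_right_mono[of \<beta> 1 "real M"] that by (simp add: nat_le_iff floor_le_iff)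
    have n_top: "filterlim n at_top sequentially"
      unfolding n_def using that by real_asymp
    have "(\<lambda>M. E2 (M - k M) / real M powr q) \<longlonglongrightarrow> c * (1 - 0) powr q"
      using k_lim \<open>\<alpha> = 0\<close> k_le
      by (intro E2_lim_along_diff id_lim) (auto intro: eventually_mono[OF eventually_ge_at_top[of 2]])
    then have L: "(\<lambda>M. E2 (M - k M) / real M powr q) \<longlonglongrightarrow> c" by simp
    have "(\<lambda>M. C * (real (n M) / real M) powr q + E2 (M - n M) / real M powr q
        + B * real M ^ 2 / real M powr q) \<longlonglongrightarrow> C * \<beta> powr q + c * (1 - \<beta>) powr q + 0"
    proof (intro tendsto_add tendsto_mult tendsto_const)
      show "(\<lambda>M. (real (n M) / real M) powr q) \<longlonglongrightarrow> \<beta> powr q"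
        using n_lim that by (intro tendsto_powr) auto
      show "(\<lambda>M. E2 (M - n M) / real M powr q) \<longlonglongrightarrow> c * (1 - \<beta>) powr q"
        using n_lim n_le by (intro E2_lim_along_diff id_lim) auto
      show "(\<lambda>M. B * real M ^ 2 / real M powr q) \<longlonglongrightarrow> 0"
        using q_gt_2 by real_asymp
    qed
    moreover have "\<forall>\<^sub>F M in sequentially. E2 (M - k M) / real M powr q \<le>
        C * (real (n M) / real M) powr q + E2 (M - n M) / real M powr q
        + B * real M ^ 2 / real M powr q"
      using eventually_compose_filterlim[OF E1_le n_top] eventually_ge_at_top[of 2]
    proof eventually_elim
      case (elim M)
      have "E2 (M - k M) \<le> C * real (n M) powr q + E2 (M - n M) + B * real M ^ 2"
        using optimal[OF elim(2) n_le[of M]] E1_nonneg[of "k M"] elim(1) by linarith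
      then have "E2 (M - k M) / real M powr q
          \<le> (C * real (n M) powr q + E2 (M - n M) + B * real M ^ 2) / real M powr q"
        by (intro divide_right_mono) auto
      then show ?case by (simp add: add_divide_distrib powr_divide)
    qed
    ultimately show ?thesis
      using L by (intro tendsto_le[OF sequentially_bot]) auto
  qed
  have "((\<lambda>\<beta>. C * \<beta> powr q / \<beta> + c * ((1 - \<beta>) powr q - 1) / \<beta>) \<longlongrightarrow> - (c * q)) (at_right 0)"
    using q_gt_2 by real_asymp
  then have "\<forall>\<^sub>F \<beta> in at_right 0. C * \<beta> powr q / \<beta> + c * ((1 - \<beta>) powr q - 1) / \<beta> < 0"
    using c_pos q_gt_2 by (intro order_tendstoD) auto
  moreover have "\<forall>\<^sub>F \<beta> in at_right 0. \<beta> \<in> {0<..<1::real}"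
    by (rule eventually_at_right_real) simp
  ultimately have "\<forall>\<^sub>F \<beta> in at_right (0::real). False"
  proof eventually_elim
    case (elim \<beta>)
    then have "C * \<beta> powr q + c * ((1 - \<beta>) powr q - 1) < 0"
      by (simp add: field_simps)
    then show False using ineq[of \<beta>] elim by (simp add: algebra_simps)
  qed
  then show False by simp
qed

definition u :: "nat \<Rightarrow> real" where
  "u N = E1 (k N) / real N powr q"

lemma u_nonneg: "0 \<le> u N"
  by (simp add: u_def E1_nonneg)

lemma Bseq_u: "Bseq u"
proof (rule BfunI)
  show "\<forall>\<^sub>F N in sequentially. norm (u N) \<le> C"
    using E1_le eventually_ge_at_top[of 2]
  proof eventually_elim
    case (elim N)
    have "E1 (k N) \<le> C * real N powr q"
      using monoD[OF mono_E1 k_le[OF elim(2)]] elim(1) by linarith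
    then show ?case using E1_nonneg[of "k N"] elim(2) by (simp add: u_def divide_le_eq)
  qed
qed

text \<open>
  Every large \<open>M\<close> is compared with the number \<open>N M\<close>, about \<open>\<rho> M\<close>: each of the two borrows the other
  one's number of points in the first part.
\<close>

context
  fixes \<rho> :: real and N :: "nat \<Rightarrow> nat"
  assumes \<rho>: "0 < \<rho>" "\<rho> < 1"
  defines "N \<equiv> \<lambda>M. nat \<lfloor>\<rho> * real M\<rfloor>"
begin

lemma N_lim: "(\<lambda>M. real (N M) / real M) \<longlonglongrightarrow> \<rho>"
  unfolding N_def using \<rho> by real_asymp

lemma N_top: "filterlim N at_top sequentially"
  unfolding N_def using \<rho> by real_asymp

lemma N_ge_2: "\<forall>\<^sub>F M in sequentially. 2 \<le> N M"
  using N_top by (simp add: filterlim_at_top)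

lemma N_le: "N M \<le> M"
  unfolding N_def using mult_right_mono[of \<rho> 1 "real M"] \<rho> by (simp add: nat_le_iff floor_le_iff)

lemma kN_lim: "(\<lambda>M. real (k (N M)) / real M) \<longlonglongrightarrow> \<alpha> * \<rho>"
proof -
  have "(\<lambda>M. real (k (N M)) / real (N M) * (real (N M) / real M)) \<longlonglongrightarrow> \<alpha> * \<rho>"
    by (intro tendsto_mult N_lim filterlim_compose[OF k_lim N_top])
  moreover have "\<forall>\<^sub>F M in sequentially.
      real (k (N M)) / real (N M) * (real (N M) / real M) = real (k (N M)) / real M"
    using N_ge_2 by eventually_elim auto
  ultimately show ?thesis by (rule Lim_transform_eventually)
qed

text \<open>
  Together with the next lemma this replaces \<open>E1 (k (N M)) / M powr q\<close> by \<open>\<rho> powr q * u (N M)\<close>. The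
  sequence \<open>u\<close> is not yet known to converge, but it is bounded, which is enough for the error.
\<close>

lemma u_rescale_error: "(\<lambda>M. u (N M) * ((real (N M) / real M) powr q - \<rho> powr q)) \<longlonglongrightarrow> 0"
proof -
  obtain K where K: "\<And>n. norm (u n) \<le> K" using Bseq_u by (auto simp: Bseq_def)
  have "(\<lambda>M. (real (N M) / real M) powr q) \<longlonglongrightarrow> \<rho> powr q"
    using \<rho> by (intro tendsto_powr N_lim) auto
  then have "(\<lambda>M. (real (N M) / real M) powr q - \<rho> powr q) \<longlonglongrightarrow> 0"
    by (rule LIM_zero)
  then show ?thesis
    using K by (intro lim_null_mult_left_bounded[where B = K]) auto
qed

lemma E1_rescale:
  assumes "2 \<le> N M"
  shows "E1 (k (N M)) / real M powr q
    = \<rho> powr q * u (N M) + u (N M) * ((real (N M) / real M) powr q - \<rho> powr q)"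
  using assms by (simp add: u_def powr_divide field_simps)

text \<open>
  At \<open>M\<close>, use the splitting that is optimal for \<open>N M\<close>. The difference in the numerator is the
  normalised increase of the energy in the second part.
\<close>

lemma u_eventually_less:
  assumes "(c * (1 - \<alpha> * \<rho>) powr q - c * (1 - \<alpha>) powr q) / (1 - \<rho> powr q) < x"
  shows "\<forall>\<^sub>F M in sequentially. u M < x"
proof (rule eventually_less_if_contracting[OF Bseq_u _ _ N_top _ _ assms])
  show "0 \<le> \<rho> powr q" "\<rho> powr q < 1"
    using \<rho> q_gt_2 powr_less_mono2[of q \<rho> 1] by auto
  let ?w = "\<lambda>M. u (N M) * ((real (N M) / real M) powr q - \<rho> powr q)
      + B * real M ^ 2 / real M powr q
      + (E2 (M - k (N M)) / real M powr q - E2 (M - k M) / real M powr q)"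
  have kN_le: "\<forall>\<^sub>F M in sequentially. k (N M) \<le> M"
    using N_ge_2 by eventually_elim (meson N_le k_le le_trans)
  have "?w \<longlonglongrightarrow> 0 + 0 + (c * (1 - \<alpha> * \<rho>) powr q - c * (1 - \<alpha>) powr q)"
  proof (intro tendsto_add tendsto_diff u_rescale_error E2_lim_along_diff id_lim kN_lim k_lim kN_le)
    show "(\<lambda>M. B * real M ^ 2 / real M powr q) \<longlonglongrightarrow> 0"
      using q_gt_2 by real_asymp
    show "\<forall>\<^sub>F M in sequentially. k M \<le> M"
      using k_le by (auto intro: eventually_mono[OF eventually_ge_at_top[of 2]])
  qed
  then show "?w \<longlonglongrightarrow> c * (1 - \<alpha> * \<rho>) powr q - c * (1 - \<alpha>) powr q" by simp
  show "\<forall>\<^sub>F M in sequentially. u M \<le> \<rho> powr q * u (N M) + ?w M"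
    using N_ge_2 kN_le eventually_ge_at_top[of 2]
  proof eventually_elim
    case (elim M)
    have "(E1 (k M) + E2 (M - k M)) / real M powr q
        \<le> (E1 (k (N M)) + E2 (M - k (N M)) + B * real M ^ 2) / real M powr q"
      using optimal[OF elim(3,2)] by (intro divide_right_mono) auto
    then show ?case
      using E1_rescale[OF elim(1)] by (simp add: add_divide_distrib u_def)
  qed
qed

text \<open>
  At \<open>N M\<close>, use the splitting that is optimal for \<open>M\<close>. It needs about \<open>\<alpha> M\<close> points in the first part
  out of \<open>\<rho> M\<close>, whence the condition \<open>\<alpha> < \<rho>\<close>. The lower bound on \<open>u\<close> is the upper bound on \<open>- u\<close>.
\<close>

lemma u_eventually_greater:
  assumes "\<alpha> < \<rho>"
    and "(c * (\<rho> - \<alpha>) powr q - c * (\<rho> - \<alpha> * \<rho>) powr q) / (1 - \<rho> powr q) < - x"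
  shows "\<forall>\<^sub>F M in sequentially. x < u M"
proof -
  have "\<forall>\<^sub>F M in sequentially. - u M < - x"
  proof (rule eventually_less_if_contracting[OF _ _ _ N_top _ _ assms(2)])
    show "Bseq (\<lambda>M. - u M)" using Bseq_u by (simp add: Bseq_minus_iff)
    show "0 \<le> \<rho> powr q" "\<rho> powr q < 1"
      using \<rho> q_gt_2 powr_less_mono2[of q \<rho> 1] by auto
    let ?w = "\<lambda>M. B * real (N M) ^ 2 / real M powr q
        - u (N M) * ((real (N M) / real M) powr q - \<rho> powr q)
        + (E2 (N M - k M) / real M powr q - E2 (N M - k (N M)) / real M powr q)"
    have k_le_N: "\<forall>\<^sub>F M in sequentially. k M \<le> N M"
    proof -
      have "(\<lambda>M. real (N M) / real M - real (k M) / real M) \<longlonglongrightarrow> \<rho> - \<alpha>"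
        by (intro tendsto_diff N_lim k_lim)
      then have "\<forall>\<^sub>F M in sequentially. 0 < real (N M) / real M - real (k M) / real M"
        using assms(1) by (intro order_tendstoD) auto
      then show ?thesis
        using eventually_gt_at_top[of 0] by eventually_elim (simp add: field_simps)
    qed
    have kN_le_N: "\<forall>\<^sub>F M in sequentially. k (N M) \<le> N M"
      using N_ge_2 by eventually_elim (rule k_le)
    have "?w \<longlonglongrightarrow> 0 - 0 + (c * (\<rho> - \<alpha>) powr q - c * (\<rho> - \<alpha> * \<rho>) powr q)"
    proof (intro tendsto_add tendsto_diff u_rescale_error E2_lim_along_diff N_lim kN_lim k_lim
        k_le_N kN_le_N)
      show "(\<lambda>M. B * real (N M) ^ 2 / real M powr q) \<longlonglongrightarrow> 0"
      proof (rule Lim_transform_eventually)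
        have "(\<lambda>M. real M ^ 2 / real M powr q) \<longlonglongrightarrow> 0" using q_gt_2 by real_asymp
        then have "(\<lambda>M. B * (real (N M) / real M) ^ 2 * (real M ^ 2 / real M powr q))
            \<longlonglongrightarrow> B * \<rho> ^ 2 * 0"
          by (intro tendsto_intros N_lim)
        then show "(\<lambda>M. B * (real (N M) / real M) ^ 2 * (real M ^ 2 / real M powr q)) \<longlonglongrightarrow> 0"
          by simp
        show "\<forall>\<^sub>F M in sequentially. B * (real (N M) / real M) ^ 2 * (real M ^ 2 / real M powr q)
            = B * real (N M) ^ 2 / real M powr q"
          using eventually_gt_at_top[of 0] by eventually_elim (simp add: power_divide)
      qed
    qed
    then show "?w \<longlonglongrightarrow> c * (\<rho> - \<alpha>) powr q - c * (\<rho> - \<alpha> * \<rho>) powr q" by simp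
    show "\<forall>\<^sub>F M in sequentially. - u M \<le> \<rho> powr q * (- u (N M)) + ?w M"
      using N_ge_2 k_le_N
    proof eventually_elim
      case (elim M)
      have "(E1 (k (N M)) + E2 (N M - k (N M))) / real M powr q
          \<le> (E1 (k M) + E2 (N M - k M) + B * real (N M) ^ 2) / real M powr q"
        using optimal[OF elim] by (intro divide_right_mono) auto
      then show ?case
        using E1_rescale[OF elim(1)] by (simp add: add_divide_distrib u_def)
    qed
  qed
  then show ?thesis by simp
qed

end

text \<open>
  For \<open>0 < \<alpha> < 1\<close> both bounds are quotients of functions vanishing at \<open>\<rho> = 1\<close>, and the quotients of
  their derivatives there agree up to sign. For \<open>\<alpha> = 1\<close> the condition \<open>\<alpha> < \<rho>\<close> cannot be met, but
  the claimed limit is \<open>0\<close> and the lower bound is nonnegativity of the energy.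
\<close>

lemma u_lim: "u \<longlonglongrightarrow> c * \<alpha> * (1 - \<alpha>) powr (q - 1)"
proof (rule order_tendstoI)
  fix x assume x: "c * \<alpha> * (1 - \<alpha>) powr (q - 1) < x"
  have "((\<lambda>\<rho>. (c * (1 - \<alpha> * \<rho>) powr q - c * (1 - \<alpha>) powr q) / (1 - \<rho> powr q))
      \<longlongrightarrow> c * \<alpha> * (1 - \<alpha>) powr (q - 1)) (at_left 1)"
  proof (cases "\<alpha> = 1")
    case True
    have "((\<lambda>\<rho>. c * (1 - \<rho>) powr q / (1 - \<rho> powr q)) \<longlongrightarrow> 0) (at_left 1)"
      using q_gt_2 by real_asymp
    then show ?thesis using True by simp
  next
    case False
    then have "\<alpha> < 1" using \<alpha>_le_1 by simp
    then show ?thesis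
      using \<alpha>_pos q_gt_2 by real_asymp (simp add: powr_diff field_simps)
  qed
  then have "\<forall>\<^sub>F \<rho> in at_left 1.
      (c * (1 - \<alpha> * \<rho>) powr q - c * (1 - \<alpha>) powr q) / (1 - \<rho> powr q) < x"
    using x by (intro order_tendstoD)
  moreover have "\<forall>\<^sub>F \<rho> in at_left 1. \<rho> \<in> {0<..<1::real}"
    by (rule eventually_at_left_real) simp
  ultimately have "\<forall>\<^sub>F \<rho> in at_left (1::real). \<forall>\<^sub>F M in sequentially. u M < x"
    by eventually_elim (rule u_eventually_less, auto)
  then show "\<forall>\<^sub>F M in sequentially. u M < x"
    by (simp add: eventually_const)
next
  fix x assume x: "x < c * \<alpha> * (1 - \<alpha>) powr (q - 1)"
  show "\<forall>\<^sub>F M in sequentially. x < u M"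
  proof (cases "\<alpha> = 1")
    case True
    then have "x < u M" for M using x u_nonneg[of M] by simp
    then show ?thesis by simp
  next
    case False
    then have "\<alpha> < 1" using \<alpha>_le_1 by simp
    have "((\<lambda>\<rho>. (c * (\<rho> - \<alpha>) powr q - c * (\<rho> - \<alpha> * \<rho>) powr q) / (1 - \<rho> powr q))
        \<longlongrightarrow> - (c * \<alpha> * (1 - \<alpha>) powr (q - 1))) (at_left 1)"
      using \<open>\<alpha> < 1\<close> \<alpha>_pos q_gt_2 by real_asymp (simp add: powr_diff field_simps)
    then have "\<forall>\<^sub>F \<rho> in at_left 1.
        (c * (\<rho> - \<alpha>) powr q - c * (\<rho> - \<alpha> * \<rho>) powr q) / (1 - \<rho> powr q) < - x"
      using x by (intro order_tendstoD) auto
    moreover have "\<forall>\<^sub>F \<rho> in at_left 1. \<rho> \<in> {\<alpha><..<1}"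
      using \<open>\<alpha> < 1\<close> by (rule eventually_at_left_real)
    ultimately have "\<forall>\<^sub>F \<rho> in at_left (1::real). \<forall>\<^sub>F M in sequentially. x < u M"
      by eventually_elim (rule u_eventually_greater, use \<alpha>_pos in auto)
    then show ?thesis by (simp add: eventually_const)
  qed
qed

lemma E1_growth: "(\<lambda>n. E1 n / real n powr q) \<longlonglongrightarrow> c * \<alpha> * (1 - \<alpha>) powr (q - 1) / \<alpha> powr q"
  using u_lim unfolding u_def by (rule tendsto_growth_if_mono[OF mono_E1 \<alpha>_pos k_lim])

end

section \<open>Weak-star convergence\<close>

lemma measure_empirical_measure:
  assumes "finite \<omega>" "B \<in> sets borel"
  shows "measure (empirical_measure \<omega>) B = real (card (\<omega> \<inter> B)) / real (card \<omega>)"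
proof -
  have "(\<Sum>x\<in>\<omega>. emeasure (return borel x) B) = (\<Sum>x\<in>\<omega>. indicator B x)"
    using assms by (intro sum.cong) auto
  also have "\<dots> = of_nat (card (\<omega> \<inter> B))"
    using assms by (simp add: indicator_def Int_def flip: sum.inter_filter)
  finally have "emeasure (empirical_measure \<omega>) B
      = ennreal (1 / real (card \<omega>)) * of_nat (card (\<omega> \<inter> B))"
    using assms by (simp add: emeasure_empirical_measure)
  also have "\<dots> = ennreal (real (card (\<omega> \<inter> B)) / real (card \<omega>))"
    by (simp add: ennreal_of_nat_eq_real_of_nat flip: ennreal_mult)
  finally show ?thesis by (simp add: measure_def)
qed

text \<open>
  Disjoint compact sets are both closed in their union, so the indicator function of \<open>A1\<close> is an
  admissible test function.
\<close>

lemma weak_star_conv_clopen: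
  fixes A1 A2 :: "'a::t2_space set"
  assumes "compact A1" "compact A2" "A1 \<inter> A2 = {}"
    and conv: "weak_star_conv (A1 \<union> A2) M \<mu>"
    and sets: "\<And>N. sets (M N) = sets borel" "sets \<mu> = sets borel"
  shows "(\<lambda>N. measure (M N) A1) \<longlonglongrightarrow> measure \<mu> A1"
proof -
  have "closed A1" "closed A2" using assms by (auto intro: compact_imp_closed)
  then have "continuous_on (A1 \<union> A2) (\<lambda>x. if x \<in> A1 then 1 else (0::real))"
    using \<open>A1 \<inter> A2 = {}\<close> by (intro continuous_on_If continuous_on_const) auto
  then have "(\<lambda>N. LINT x:A1 \<union> A2|M N. if x \<in> A1 then 1 else (0::real))
      \<longlonglongrightarrow> (LINT x:A1 \<union> A2|\<mu>. if x \<in> A1 then 1 else (0::real))"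
    using conv unfolding weak_star_conv_def by blast
  moreover have "(LINT x:A1 \<union> A2|\<nu>. if x \<in> A1 then 1 else (0::real)) = measure \<nu> A1"
    if "sets \<nu> = sets borel" for \<nu> :: "'a measure"
  proof -
    have "(LINT x:A1 \<union> A2|\<nu>. if x \<in> A1 then 1 else (0::real)) = (LINT x|\<nu>. indicator A1 x)"
      unfolding set_lebesgue_integral_def by (intro Bochner_Integration.integral_cong) auto
    also have "\<dots> = measure \<nu> (A1 \<inter> space \<nu>)" by simp
    also have "A1 \<inter> space \<nu> = A1" using sets_eq_imp_space_eq[OF that] by simp
    finally show ?thesis .
  qed
  ultimately show ?thesis using sets by simp
qed

theorem theorem1p1:
  fixes A A1 A2 :: "(real ^ 'p) set"
    and s d :: real
    and \<omega> :: "nat \<Rightarrow> (real ^ 'p) set"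
  assumes "A = A1 \<union> A2" and "A1 \<inter> A2 = {}"
    and "compact A1" and "compact A2"
    and "d > 0"
    and "hausdorff_dim A1 = ereal d" and "hausdorff_dim A2 = ereal d"
    and "s > d"
    and "diameter A1 < setdist A1 A2" and "diameter A2 < setdist A1 A2"
    and "0 < g_lower s d A1" and "g_lower s d A1 < g_upper s d A1" and "g_upper s d A1 < \<infinity>"
    and "g_exists s d A2" and "0 < g_val s d A2" and "g_val s d A2 < \<infinity>"
    and "\<And>N. N \<ge> 2 \<Longrightarrow> minimal_configuration s A N (\<omega> N)"
  shows "\<not> (\<exists>\<mu> \<in> prob_measures_on A. weak_star_conv A (\<lambda>N. empirical_measure (\<omega> N)) \<mu>)"
proof
  assume "\<exists>\<mu> \<in> prob_measures_on A. weak_star_conv A (\<lambda>N. empirical_measure (\<omega> N)) \<mu>"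
  then obtain \<mu> where \<mu>: "sets \<mu> = sets borel" "weak_star_conv A (\<lambda>N. empirical_measure (\<omega> N)) \<mu>"
    by (auto simp: prob_measures_on_def)
  have inf: "infinite A1" "infinite A2"
    using assms infinite_if_g_lower_pos[of s d] by (auto simp: g_val_def)
  \<comment> \<open>The distance exceeds a diameter, and diameters of bounded sets are nonnegative.\<close>
  have D: "0 < setdist A1 A2"
    using assms diameter_ge_0[OF compact_imp_bounded, of A1] by linarith
  have "0 < s" using assms by simp
  define q where "q = 1 + s / d"
  define k where "k N = card (\<omega> N \<inter> A1)" for N
  have k_lim: "(\<lambda>N. real (k N) / real N) \<longlonglongrightarrow> measure \<mu> A1"
  proof (rule Lim_transform_eventually)
    show "(\<lambda>N. measure (empirical_measure (\<omega> N)) A1) \<longlonglongrightarrow> measure \<mu> A1"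
      using assms \<mu> by (intro weak_star_conv_clopen[of A1 A2]) auto
    show "\<forall>\<^sub>F N in sequentially. measure (empirical_measure (\<omega> N)) A1 = real (k N) / real N"
      using eventually_ge_at_top[of 2]
    proof eventually_elim
      case (elim N)
      then show ?case
        using assms(17)[OF elim] borel_compact[OF assms(3)]
        by (simp add: measure_empirical_measure k_def minimal_configuration_def configurations_def)
    qed
  qed
  obtain C where "g_upper s d A1 < ereal C"
    using assms ereal_dense2[of "g_upper s d A1" \<infinity>] by auto
  then have C: "\<forall>\<^sub>F n in sequentially. min_energy s A1 n / real n powr q < C"
    unfolding g_upper_def q_def by (auto dest: Limsup_lessD)
  obtain c where c: "g_val s d A2 = ereal c" "0 < c"
    using assms by (cases "g_val s d A2") auto
  have "(\<lambda>n. ereal (min_energy s A2 n / real n powr q)) \<longlonglongrightarrow> ereal c"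
    using c assms
    by (simp add: tendsto_iff_Liminf_eq_Limsup g_exists_def g_val_def g_lower_def g_upper_def q_def)
  then have c_lim: "(\<lambda>n. min_energy s A2 n / real n powr q) \<longlonglongrightarrow> c" by simp
  interpret optimal_splitting "min_energy s A1" "min_energy s A2" k q "2 / setdist A1 A2 powr s" C c
      "measure \<mu> A1"
  proof
    show "\<forall>\<^sub>F n in sequentially. min_energy s A1 n \<le> C * real n powr q"
      using C eventually_gt_at_top[of 0] by eventually_elim (simp add: divide_less_eq)
    show "2 < q" using assms by (simp add: q_def)
    show "min_energy s A2 0 = 0" by (simp add: min_energy_def)
    fix N n :: nat assume "2 \<le> N"
    then have min: "minimal_configuration s (A1 \<union> A2) N (\<omega> N)" using assms(1,17) by simp
    then show "k N \<le> N"
      unfolding k_def by (rule minimal_configuration_split(1)[OF inf D \<open>0 < s\<close> _ order_refl])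
    assume "n \<le> N"
    with min show "min_energy s A1 (k N) + min_energy s A2 (N - k N)
        \<le> min_energy s A1 n + min_energy s A2 (N - n) + 2 / setdist A1 A2 powr s * real N ^ 2"
      unfolding k_def by (rule minimal_configuration_split(2)[OF inf D \<open>0 < s\<close>])
  qed (use mono_min_energy[OF inf(1)] min_energy_nonneg[OF inf(1)] k_lim c_lim c in auto)
  have "(\<lambda>n. ereal (min_energy s A1 n / real n powr q))
      \<longlonglongrightarrow> ereal (c * measure \<mu> A1 * (1 - measure \<mu> A1) powr (q - 1) / measure \<mu> A1 powr q)"
    using E1_growth by simp
  then have "g_lower s d A1 = g_upper s d A1"
    unfolding g_lower_def g_upper_def q_def
    by (simp only: tendsto_iff_Liminf_eq_Limsup[OF sequentially_bot])
  then show False using assms by simp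
qed

end
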